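(* Let $L>0$, $M\in\mathbb R$, let $f\in\mathcal F_L(\mathbb R^n)$ satisfy $f^*\le M$, and let $(x^{(k)})_{k\in\mathbb N}$ be the trajectory of the accelerated gradient method (defined in the context) with initial point $x_0:=0$ and parameters $(A_k)_{k\in\mathbb N}$ satisfying the step-size condition stated there. Let $p^\star$ be the minimum-norm point of $\overline{\operatorname{dom} f^*}$, and let $q^{(k)},\tilde B_k,p^{(k)},B_k$ ($k\ge1$) be as defined in the context. Then: (a) For all $k\ge1$, $\|q^{(k)}-p^\star\|^2\le\tilde B_k(M+f(0))$. (b) If $\|q^{(k)}\|^2>\tilde B_k(M+f(0))$ for some $k\ge1$, then $f$ is lower-unbounded, i.e. $\inf_{x\in\mathbb R^n}f(x)=-\infty$. (c) If $p^\star\ne0$, then the inequality $\|q^{(k)}\|^2>\tilde B_k(M+f(0))$ holds for all $k\ge1$ satisfying $\tilde B_k<\dfrac{\|p^\star\|^2}{M+f(0)}$ (the right-hand side being read as $+\infty$ if $M+f(0)=0$). The same claims (a)--(c) also hold with $(p^{(k)},B_k)$ in place of $(q^{(k)},\tilde B_k)$.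
   Context: $\|\cdot\|$ and $\langle\cdot,\cdot\rangle$ are the Euclidean norm and inner product on $\mathbb R^n$. For $L>0$, $\mathcal F_L(\mathbb R^n)$ is the set of finite-valued differentiable convex functions $f:\mathbb R^n\to\mathbb R$ whose gradient is $L$-Lipschitz. The Legendre--Fenchel conjugate is $f^*(p):=\sup_{x\in\mathbb R^n}\{\langle p,x\rangle-f(x)\}\in\mathbb R\cup\{\infty\}$, and $\operatorname{dom} f^*:=\{p: f^*(p)<\infty\}$, a nonempty convex set. The notation $f^*\le M$ means $f^*(p)\le M$ for all $p\in\operatorname{dom} f^*$. Accelerated gradient method: let $(A_k)_{k\in\mathbb N}$ be real numbers with $\delta^+A_k:=A_{k+1}-A_k$ satisfying the step-size condition $$A_0=0,\qquad 0<\delta^+A_k\le 2\sqrt{A_{k+1}/L}\ \ (\forall k\in\mathbb N),\qquad \delta^+A_k=\Theta(k)\ (k\to\infty).$$ Set $x^{(0)}:=y^{(0)}:=x_0$ and, for $k\in\mathbb N$, $$x^{(k+1)}:=y^{(k)}-\frac{(\delta^+A_k)^2}{4A_{k+1}}\nabla f(y^{(k)}),\qquad y^{(k+1)}:=x^{(k+1)}+\frac{A_k\,\delta^+A_{k+1}}{A_{k+2}\,\delta^+A_k}\,(x^{(k+1)}-x^{(k)}).$$ For $k\ge1$: $$p^{(k)}:=-\frac{4A_kA_{k+1}}{(\delta^+A_k)\sum_{i=1}^kA_i\,\delta^+A_i}\,(x^{(k+1)}-x^{(k)}),\qquad B_k:=8\left(\frac{A_k\sqrt{A_{k+1}}+\sum_{i=1}^k\sqrt{A_i}\,\delta^+A_{i-1}}{\sum_{i=1}^kA_i\,\delta^+A_i}\right)^2,$$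 $$q^{(k)}:=-\frac{4A_k}{\sum_{i=1}^kA_i\,\delta^+A_{i-1}}\,(x^{(k)}-x_0),\qquad \tilde B_k:=8\left(\frac{\sum_{i=1}^k\sqrt{A_i}\,\delta^+A_{i-1}}{\sum_{i=1}^kA_i\,\delta^+A_{i-1}}\right)^2.$$ *)

theory Defs
  imports "HOL-Analysis.Analysis" "HOL-Library.Landau_Symbols"
begin

definition grad :: "('a::real_inner \<Rightarrow> real) \<Rightarrow> 'a \<Rightarrow> 'a" where
  "grad f x = (THE d. GDERIV f x :> d)"

definition smooth_convex :: "real \<Rightarrow> ('a::euclidean_space \<Rightarrow> real) set" where
  "smooth_convex L = {f. convex_on UNIV f \<and> (\<forall>x. f differentiable (at x)) \<and> L-lipschitz_on UNIV (grad f)}"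

definition conjugate :: "('a::real_inner \<Rightarrow> real) \<Rightarrow> 'a \<Rightarrow> ereal" where
  "conjugate f p = (SUP x. ereal (p \<bullet> x - f x))"

definition conj_dom :: "('a::real_inner \<Rightarrow> real) \<Rightarrow> 'a set" where
  "conj_dom f = {p. conjugate f p < \<infinity>}"

text \<open>\<open>closest_point\<close> is a choice operator: this is the unique minimum-norm point when \<open>S\<close> is
  nonempty, closed and convex, and unspecified when no minimiser exists.\<close>

definition min_norm_point :: "'a::euclidean_space set \<Rightarrow> 'a" where
  "min_norm_point S = closest_point S 0"

definition fwd_diff :: "(nat \<Rightarrow> real) \<Rightarrow> nat \<Rightarrow> real" ("\<delta>") where
  "\<delta> A k = A (k + 1) - A k"

definition step_size_condition :: "real \<Rightarrow> (nat \<Rightarrow> real) \<Rightarrow> bool" where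
  "step_size_condition L A \<longleftrightarrow>
     A 0 = 0 \<and>
     (\<forall>k. 0 < \<delta> A k \<and> \<delta> A k \<le> 2 * sqrt (A (k + 1) / L)) \<and>
     \<delta> A \<in> \<Theta>(\<lambda>k. real k)"

fun agm_x agm_y :: "('a::real_inner \<Rightarrow> real) \<Rightarrow> (nat \<Rightarrow> real) \<Rightarrow> 'a \<Rightarrow> nat \<Rightarrow> 'a" where
  "agm_x f A x0 0 = x0"
| "agm_x f A x0 (Suc k) =
     agm_y f A x0 k - ((\<delta> A k)\<^sup>2 / (4 * A (k + 1))) *\<^sub>R grad f (agm_y f A x0 k)"
| "agm_y f A x0 0 = x0"
| "agm_y f A x0 (Suc k) =
     agm_x f A x0 (Suc k)
       + (A k * \<delta> A (k + 1) / (A (k + 2) * \<delta> A k)) *\<^sub>R (agm_x f A x0 (Suc k) - agm_x f A x0 k)"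

text \<open>The four quantities below are only meaningful for \<open>k \<ge> 1\<close>; there the sums start at \<open>i = 1\<close>, so
  the subtraction in \<open>\<delta> A (i - 1)\<close> never truncates.\<close>

definition agm_p :: "('a::real_inner \<Rightarrow> real) \<Rightarrow> (nat \<Rightarrow> real) \<Rightarrow> 'a \<Rightarrow> nat \<Rightarrow> 'a" where
  "agm_p f A x0 k =
     - ((4 * A k * A (k + 1) / (\<delta> A k * (\<Sum>i=1..k. A i * \<delta> A i))) *\<^sub>R
         (agm_x f A x0 (k + 1) - agm_x f A x0 k))"

definition bound_p :: "(nat \<Rightarrow> real) \<Rightarrow> nat \<Rightarrow> real" where
  "bound_p A k =
     8 * ((A k * sqrt (A (k + 1)) + (\<Sum>i=1..k. sqrt (A i) * \<delta> A (i - 1)))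
            / (\<Sum>i=1..k. A i * \<delta> A i))\<^sup>2"

definition agm_q :: "('a::real_inner \<Rightarrow> real) \<Rightarrow> (nat \<Rightarrow> real) \<Rightarrow> 'a \<Rightarrow> nat \<Rightarrow> 'a" where
  "agm_q f A x0 k =
     - ((4 * A k / (\<Sum>i=1..k. A i * \<delta> A (i - 1))) *\<^sub>R (agm_x f A x0 k - x0))"

definition bound_q :: "(nat \<Rightarrow> real) \<Rightarrow> nat \<Rightarrow> real" where
  "bound_q A k =
     8 * ((\<Sum>i=1..k. sqrt (A i) * \<delta> A (i - 1)) / (\<Sum>i=1..k. A i * \<delta> A (i - 1)))\<^sup>2"

end

theory Submission
  imports Defs
begin

text \<open>
  Write \<open>g j\<close> for the gradient at \<open>y j\<close>, \<open>G k\<close> for the sum of \<open>\<delta> A j *\<^sub>R g j\<close> over \<open>j < k\<close>, and \<open>P\<close> for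
  the minimum-norm point. An estimate-sequence argument bounds \<open>A k * f (x k)\<close> from above by
  \<open>A k * f 0 - \<parallel>G k\<parallel>\<^sup>2 / 8\<close>, less a multiple of \<open>\<parallel>P\<parallel>\<^sup>2\<close>, and Fenchel's inequality at \<open>P\<close> bounds \<open>f (x k)\<close> from below by
  \<open>P \<bullet> x k - M\<close>. All gradients lie in the domain of the conjugate, so \<open>g j \<bullet> P \<ge> \<parallel>P\<parallel>\<^sup>2\<close>. Combining
  these gives \<open>\<parallel>G k - A k *\<^sub>R P\<parallel>\<^sup>2 \<le> 8 * A k * (M + f 0)\<close>. Both certificates are linear combinations of
  the averages \<open>G k / A k\<close> with total weight 1, and also averages of gradients, so (a) follows from
  the triangle inequality; (b) holds because \<open>P = 0\<close> if \<open>f\<close> is bounded below, and (c) because every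
  average of gradients has norm at least \<open>\<parallel>P\<parallel>\<close>.
\<close>

section \<open>Smooth convex functions\<close>

text \<open>The \<open>THE\<close> in \<open>grad\<close> needs existence, given by the Riesz
  representative \<open>adjoint f' 1\<close> of the derivative, and uniqueness, inherited from that
  of derivatives.\<close>

lemma GDERIV_grad:
  fixes f :: "'a::euclidean_space \<Rightarrow> real"
  assumes "f differentiable (at x)"
  shows "GDERIV f x :> grad f x"
proof -
  obtain f' where f': "(f has_derivative f') (at x)"
    using assms by (auto simp: differentiable_def)
  then have "linear f'"
    by (rule has_derivative_linear)
  then have "f' = (\<lambda>h. h \<bullet> adjoint f' 1)"
    by (simp add: adjoint_works)
  with f' have "GDERIV f x :> adjoint f' 1"
    by (simp add: gderiv_def)
  moreover have "d = e" if "GDERIV f x :> d" "GDERIV f x :> e" for d e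
    using has_derivative_unique[OF that[unfolded gderiv_def]]
    by (metis inner_commute vector_eq_ldot)
  ultimately show ?thesis
    unfolding grad_def by (metis theI)
qed

context
  fixes f :: "'a::euclidean_space \<Rightarrow> real" and L :: real
  assumes f: "f \<in> smooth_convex L"
begin

lemma DERIV_along_line:
  "((\<lambda>t. f (x + t *\<^sub>R d)) has_real_derivative grad f (x + t *\<^sub>R d) \<bullet> d) (at t)"
proof -
  have "GDERIV f (x + t *\<^sub>R d) :> grad f (x + t *\<^sub>R d)"
    using f by (intro GDERIV_grad) (simp add: smooth_convex_def)
  then have "(f has_derivative (\<lambda>h. h \<bullet> grad f (x + t *\<^sub>R d))) (at (x + t *\<^sub>R d))"
    by (simp add: gderiv_def)
  moreover have "((\<lambda>t. x + t *\<^sub>R d) has_derivative (\<lambda>h. h *\<^sub>R d)) (at t)"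
    by (auto intro!: derivative_eq_intros)
  ultimately have "((\<lambda>t. f (x + t *\<^sub>R d)) has_derivative (\<lambda>h. (h *\<^sub>R d) \<bullet> grad f (x + t *\<^sub>R d))) (at t)"
    by (rule has_derivative_compose[rotated])
  then show ?thesis
    by (simp add: has_field_derivative_def inner_commute mult.commute[of _ "_ \<bullet> _"])
qed

lemma smooth_convex_above_tangent:
  "f x + grad f x \<bullet> (y - x) \<le> f y"
proof -
  define \<phi> where "\<phi> t = f (x + t *\<^sub>R (y - x))" for t
  have cf: "convex_on UNIV f"
    using f by (simp add: smooth_convex_def)
  have "convex_on UNIV \<phi>"
  proof (intro convex_onI)
    fix t u v :: real
    assume "0 < t" "t < 1"
    moreover have "x + ((1 - t) *\<^sub>R u + t *\<^sub>R v) *\<^sub>R (y - x)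
        = (1 - t) *\<^sub>R (x + u *\<^sub>R (y - x)) + t *\<^sub>R (x + v *\<^sub>R (y - x))"
      by (simp add: algebra_simps)
    ultimately show "\<phi> ((1 - t) *\<^sub>R u + t *\<^sub>R v) \<le> (1 - t) * \<phi> u + t * \<phi> v"
      unfolding \<phi>_def using convex_onD[OF cf, of t] by simp
  qed simp
  moreover have "(\<phi> has_real_derivative grad f x \<bullet> (y - x)) (at 0 within UNIV)"
    using DERIV_along_line[of x "y - x" 0] by (simp add: \<phi>_def[abs_def])
  ultimately have "\<phi> 1 - \<phi> 0 \<ge> grad f x \<bullet> (y - x) * (1 - 0)"
    by (intro convex_on_imp_above_tangent) auto
  then show ?thesis
    by (simp add: \<phi>_def)
qed

lemma smooth_convex_descent:
  "f (x + d) \<le> f x + grad f x \<bullet> d + L / 2 * (norm d)\<^sup>2"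
proof -
  \<comment> \<open>Subtracting the nonconstant part of the claimed bound turns the Lipschitz
    condition into a sign condition on the derivative.\<close>
  define \<phi> where "\<phi> t = f (x + t *\<^sub>R d) - t * (grad f x \<bullet> d) - L / 2 * t\<^sup>2 * (norm d)\<^sup>2" for t
  have "\<exists>D. (\<phi> has_real_derivative D) (at t) \<and> D \<le> 0" if "0 \<le> t" for t
  proof (intro exI conjI)
    show "(\<phi> has_real_derivative grad f (x + t *\<^sub>R d) \<bullet> d - grad f x \<bullet> d - L * t * (norm d)\<^sup>2) (at t)"
      unfolding \<phi>_def
      by (rule derivative_eq_intros DERIV_along_line refl | simp)+
    have "L-lipschitz_on UNIV (grad f)"
      using f by (simp add: smooth_convex_def)
    from lipschitz_onD[OF this, of "x + t *\<^sub>R d" x]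
    have "norm (grad f (x + t *\<^sub>R d) - grad f x) \<le> L * (t * norm d)"
      using that by (simp add: dist_norm)
    then have "norm (grad f (x + t *\<^sub>R d) - grad f x) * norm d \<le> L * t * (norm d)\<^sup>2"
      by (metis ab_semigroup_mult_class.mult_ac(1) mult_right_mono norm_ge_zero power2_eq_square)
    with norm_cauchy_schwarz[of "grad f (x + t *\<^sub>R d) - grad f x" d]
    show "grad f (x + t *\<^sub>R d) \<bullet> d - grad f x \<bullet> d - L * t * (norm d)\<^sup>2 \<le> 0"
      by (simp add: inner_diff_left)
  qed
  then have "\<phi> 1 \<le> \<phi> 0"
    by (intro DERIV_nonpos_imp_nonincreasing[of 0 1]) auto
  then show ?thesis
    by (simp add: \<phi>_def)
qed

lemma smooth_convex_cocoercive:
  assumes "L > 0"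
  shows "f x + grad f x \<bullet> (y - x) + (norm (grad f y - grad f x))\<^sup>2 / (2 * L) \<le> f y"
proof -
  define e where "e = grad f y - grad f x"
  \<comment> \<open>The point \<open>y - (1 / L) *\<^sub>R e\<close> minimises the gap between the
    quadratic upper model at \<open>y\<close> and the tangent at \<open>x\<close>.\<close>
  have "f x + grad f x \<bullet> (y - (1 / L) *\<^sub>R e - x) \<le> f (y + - (1 / L) *\<^sub>R e)"
    using smooth_convex_above_tangent[of x "y - (1 / L) *\<^sub>R e"] by simp
  also have "\<dots> \<le> f y + grad f y \<bullet> (- (1 / L) *\<^sub>R e) + L / 2 * (norm (- (1 / L) *\<^sub>R e))\<^sup>2"
    by (rule smooth_convex_descent)
  also have "L / 2 * (norm (- (1 / L) *\<^sub>R e))\<^sup>2 = (norm e)\<^sup>2 / (2 * L)"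
    using assms by (simp add: power_mult_distrib power2_eq_square field_simps)
  finally have "f x + grad f x \<bullet> (y - x) + (1 / L) * ((grad f y - grad f x) \<bullet> e) - (norm e)\<^sup>2 / (2 * L) \<le> f y"
    by (simp add: inner_diff_left inner_diff_right algebra_simps diff_divide_distrib)
  then show ?thesis
    unfolding e_def[symmetric] dot_square_norm by simp
qed

text \<open>For linear \<open>f\<close> this is an equality, whereas the usual descent estimate lacks the term in the
  gradient at the new point and is not sharp enough for the constant 8 in the final bounds.\<close>

lemma gradient_step_descent:
  fixes y :: 'a
  assumes "L > 0" "0 \<le> s" "s \<le> 1 / L"
  defines "x \<equiv> y - s *\<^sub>R grad f y"
  shows "f x \<le> f y - s / 2 * (norm (grad f y))\<^sup>2 - s / 2 * (norm (grad f x))\<^sup>2"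
proof -
  define e where "e = (norm (grad f y - grad f x))\<^sup>2"
  \<comment> \<open>With weight \<open>s / 2\<close>, the mixed product in the expansion of
    \<open>e\<close> cancels \<open>s * (grad f x \<bullet> grad f y)\<close> exactly.\<close>
  have "s / 2 * e \<le> e / (2 * L)"
    using mult_right_mono[OF assms(3), of "e / 2"] by (simp add: e_def)
  moreover have "f x + s * (grad f x \<bullet> grad f y) + e / (2 * L) \<le> f y"
    using smooth_convex_cocoercive[OF \<open>L > 0\<close>, of x y] by (simp add: x_def e_def)
  moreover have "e = (norm (grad f y))\<^sup>2 + (norm (grad f x))\<^sup>2 - 2 * (grad f x \<bullet> grad f y)"
    by (simp add: e_def power2_norm_eq_inner algebra_simps inner_commute)
  ultimately show ?thesis
    by (simp add: algebra_simps)
qed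

end

section \<open>The domain of the conjugate\<close>

lemma conjugate_le_iff: "conjugate f v \<le> ereal c \<longleftrightarrow> (\<forall>x. v \<bullet> x - f x \<le> c)"
  by (simp add: conjugate_def SUP_le_iff)

lemma conj_domI: "(\<And>x. v \<bullet> x - f x \<le> c) \<Longrightarrow> v \<in> conj_dom f"
  unfolding conj_dom_def using conjugate_le_iff[of f v c]
  by (auto intro: le_less_trans)

lemma conj_domE:
  assumes "v \<in> conj_dom f"
  obtains c where "\<And>x. v \<bullet> x - f x \<le> c"
proof -
  have "conjugate f v < \<infinity>"
    using assms by (simp add: conj_dom_def)
  then obtain c where "conjugate f v \<le> ereal c"
    by (cases "conjugate f v") auto
  then have "\<And>x. v \<bullet> x - f x \<le> c"
    by (simp add: conjugate_le_iff)
  then show thesis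
    by (rule that)
qed

lemma convex_conj_dom: "convex (conj_dom f)"
proof (rule convexI)
  fix v w and s t :: real
  assume vw: "v \<in> conj_dom f" "w \<in> conj_dom f" and st: "0 \<le> s" "0 \<le> t" "s + t = 1"
  obtain c where c: "\<And>x. v \<bullet> x - f x \<le> c" using conj_domE[OF vw(1)] by blast
  obtain d where d: "\<And>x. w \<bullet> x - f x \<le> d" using conj_domE[OF vw(2)] by blast
  show "s *\<^sub>R v + t *\<^sub>R w \<in> conj_dom f"
  proof (rule conj_domI)
    fix x
    have "(s *\<^sub>R v + t *\<^sub>R w) \<bullet> x - f x = s * (v \<bullet> x - f x) + t * (w \<bullet> x - f x)"
    proof -
      have "f x = s * f x + t * f x"
        using st(3) by (metis distrib_right mult_1)
      then show ?thesis
        by (simp add: inner_add_left right_diff_distrib)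
    qed
    also have "\<dots> \<le> s * c + t * d"
      using st c d by (intro add_mono mult_left_mono)
    finally show "(s *\<^sub>R v + t *\<^sub>R w) \<bullet> x - f x \<le> s * c + t * d" .
  qed
qed

text \<open>By the tangent inequality, the supremum defining the conjugate at
  \<open>grad f y\<close> is attained at \<open>y\<close>.\<close>

lemma grad_in_conj_dom:
  fixes f :: "'a::euclidean_space \<Rightarrow> real"
  assumes "f \<in> smooth_convex L"
  shows "grad f y \<in> conj_dom f"
proof (rule conj_domI)
  show "grad f y \<bullet> x - f x \<le> grad f y \<bullet> y - f y" for x
    using smooth_convex_above_tangent[OF assms, of y x] by (simp add: inner_diff_right)
qed

lemma min_norm_point_in_closure:
  fixes S :: "'a::euclidean_space set"
  assumes "S \<noteq> {}"
  shows "min_norm_point (closure S) \<in> closure S"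
  unfolding min_norm_point_def using assms by (intro closest_point_in_set) auto

text \<open>Variational inequality for the projection of 0 onto the closed convex set
  \<open>closure S\<close>.\<close>

lemma min_norm_point_inner:
  fixes S :: "'a::euclidean_space set"
  assumes "convex S" "v \<in> S"
  shows "(norm (min_norm_point (closure S)))\<^sup>2 \<le> v \<bullet> min_norm_point (closure S)"
proof -
  have "v \<in> closure S"
    using assms closure_subset by blast
  then show ?thesis
    using closest_point_dot[of "closure S" v 0] assms
    by (simp add: min_norm_point_def convex_closure power2_norm_eq_inner algebra_simps inner_commute)
qed

lemma norm_le_if_power2_norm_le_inner:
  fixes u v :: "'a::real_inner"
  assumes "(norm u)\<^sup>2 \<le> v \<bullet> u"
  shows "norm u \<le> norm v"
proof (cases "u = 0")
  case False
  have "norm u * norm u \<le> norm v * norm u"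
    using assms norm_cauchy_schwarz[of v u] by (simp add: power2_eq_square)
  then show ?thesis
    using False by simp
qed simp

section \<open>The accelerated gradient method\<close>

locale agm =
  fixes f :: "'a::euclidean_space \<Rightarrow> real" and L M :: real and A :: "nat \<Rightarrow> real"
  assumes L: "L > 0"
    and f: "f \<in> smooth_convex L"
    and M: "\<forall>v\<in>conj_dom f. conjugate f v \<le> ereal M"
    and A: "step_size_condition L A"
begin

abbreviation "x \<equiv> agm_x f A 0"
abbreviation "y \<equiv> agm_y f A 0"
abbreviation "g j \<equiv> grad f (y j)"

definition "P = min_norm_point (closure (conj_dom f))"

definition "G k = (\<Sum>j<k. \<delta> A j *\<^sub>R g j)"

section \<open>Step sizes and closed forms of the iterates\<close>

lemma A_0: "A 0 = 0"
  using A by (simp add: step_size_condition_def)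

lemma delta_pos: "0 < \<delta> A k"
  using A by (simp add: step_size_condition_def)

lemma A_Suc: "A (Suc k) = A k + \<delta> A k"
  by (simp add: fwd_diff_def)

lemma A_nonneg: "0 \<le> A k"
  by (induction k) (use delta_pos in \<open>auto simp: A_0 A_Suc intro: add_nonneg_nonneg less_imp_le\<close>)

lemma A_pos: "k > 0 \<Longrightarrow> 0 < A k"
  by (cases k) (use A_nonneg delta_pos in \<open>auto simp: A_Suc intro: add_nonneg_pos\<close>)

text \<open>Squared form of the step-size condition, as \<open>gradient_step_descent\<close>
  requires it.\<close>

lemma step_le: "(\<delta> A k)\<^sup>2 / (4 * A (Suc k)) \<le> 1 / L"
proof -
  have "\<delta> A k \<le> 2 * sqrt (A (Suc k) / L)"
    using A by (simp add: step_size_condition_def)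
  then have "(\<delta> A k)\<^sup>2 \<le> (2 * sqrt (A (Suc k) / L))\<^sup>2"
    using delta_pos[of k] by (intro power_mono) auto
  also have "\<dots> = 4 * A (Suc k) / L"
    using L A_nonneg by (simp add: power_mult_distrib)
  finally show ?thesis
    using A_pos[of "Suc k"] L by (simp add: field_simps)
qed

lemma G_Suc: "G (Suc k) = G k + \<delta> A k *\<^sub>R g k"
  by (simp add: G_def)

text \<open>The point \<open>- G k / 4\<close> is the usual mirror sequence of the method.\<close>

lemma y_x_eq: "A (Suc k) *\<^sub>R y k = A k *\<^sub>R x k - (\<delta> A k / 4) *\<^sub>R G k"
  and x_Suc_eq: "A (Suc k) *\<^sub>R x (Suc k) = A k *\<^sub>R x k - (\<delta> A k / 4) *\<^sub>R G (Suc k)"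
proof -
  \<comment> \<open>The \<open>x\<close> identity follows from the \<open>y\<close> identity at the
    same index, and the induction for \<open>y\<close> uses it in turn.\<close>
  have step: "A (Suc k) *\<^sub>R x (Suc k) = A k *\<^sub>R x k - (\<delta> A k / 4) *\<^sub>R G (Suc k)"
    if "A (Suc k) *\<^sub>R y k = A k *\<^sub>R x k - (\<delta> A k / 4) *\<^sub>R G k" for k
  proof -
    have "A (Suc k) *\<^sub>R x (Suc k)
        = A (Suc k) *\<^sub>R y k - (A (Suc k) * ((\<delta> A k)\<^sup>2 / (4 * A (Suc k)))) *\<^sub>R g k"
      by (simp add: scaleR_diff_right)
    also have "A (Suc k) * ((\<delta> A k)\<^sup>2 / (4 * A (Suc k))) = \<delta> A k / 4 * \<delta> A k"
      using A_pos[of "Suc k"] by (simp add: power2_eq_square)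
    finally show ?thesis
      by (simp add: that G_Suc scaleR_add_right)
  qed
  show y: "A (Suc k) *\<^sub>R y k = A k *\<^sub>R x k - (\<delta> A k / 4) *\<^sub>R G k"
  proof (induction k)
    case 0
    then show ?case by (simp add: G_def)
  next
    case (Suc k)
    define d where "d = \<delta> A (Suc k) / \<delta> A k"
    have "A (Suc (Suc k)) * (A k * \<delta> A (Suc k) / (A (Suc (Suc k)) * \<delta> A k)) = d * A k"
      using A_pos[of "Suc (Suc k)"] by (simp add: d_def)
    then have "A (Suc (Suc k)) *\<^sub>R y (Suc k)
        = A (Suc (Suc k)) *\<^sub>R x (Suc k) + (d * A k) *\<^sub>R (x (Suc k) - x k)"
      by (simp add: scaleR_add_right del: agm_x.simps)
    \<comment> \<open>The momentum coefficient is tuned so that the leftover multiple of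
      \<open>x (Suc k)\<close> vanishes.\<close>
    also have "\<dots> = A (Suc k) *\<^sub>R x (Suc k) + d *\<^sub>R (A (Suc k) *\<^sub>R x (Suc k) - A k *\<^sub>R x k)
        + (\<delta> A (Suc k) - d * \<delta> A k) *\<^sub>R x (Suc k)"
      by (simp add: A_Suc algebra_simps del: agm_x.simps)
    also have "\<delta> A (Suc k) - d * \<delta> A k = 0"
      using delta_pos[of k] by (simp add: d_def)
    also have "A (Suc k) *\<^sub>R x (Suc k) - A k *\<^sub>R x k = - (\<delta> A k / 4) *\<^sub>R G (Suc k)"
      using step[OF Suc] by (simp del: agm_x.simps)
    also have "d *\<^sub>R (- (\<delta> A k / 4) *\<^sub>R G (Suc k)) = - (\<delta> A (Suc k) / 4) *\<^sub>R G (Suc k)"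
      using delta_pos[of k] by (simp add: d_def)
    finally show ?case
      by (simp del: agm_x.simps)
  qed
  show "A (Suc k) *\<^sub>R x (Suc k) = A k *\<^sub>R x k - (\<delta> A k / 4) *\<^sub>R G (Suc k)"
    by (rule step[OF y])
qed

text \<open>Telescopes \<open>x_Suc_eq\<close> from \<open>A 0 = 0\<close>; both certificates are
  rewritten through it.\<close>

lemma x_eq: "A k *\<^sub>R x k = - (1 / 4) *\<^sub>R (\<Sum>i=1..k. \<delta> A (i - 1) *\<^sub>R G i)"
proof (induction k)
  case (Suc k)
  then show ?case
    by (simp add: x_Suc_eq scaleR_add_right del: agm_x.simps)
qed simp

section \<open>Inequalities at the minimum-norm point\<close>

lemma conj_dom_nonempty: "conj_dom f \<noteq> {}"
  using grad_in_conj_dom[OF f] by blast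

text \<open>For fixed \<open>z\<close> the inequality is a closed condition on \<open>v\<close>. The
  closure matters because \<open>P\<close> may lie outside \<open>conj_dom f\<close>.\<close>

lemma conj_le: "v \<in> closure (conj_dom f) \<Longrightarrow> v \<bullet> z - f z \<le> M"
proof -
  have "closure (conj_dom f) \<subseteq> {v. v \<bullet> z - f z \<le> M}"
  proof (rule closure_minimal)
    show "conj_dom f \<subseteq> {v. v \<bullet> z - f z \<le> M}"
      using M by (auto simp: conjugate_le_iff)
    show "closed {v. v \<bullet> z - f z \<le> M}"
      by (intro closed_Collect_le continuous_intros)
  qed
  then show "v \<in> closure (conj_dom f) \<Longrightarrow> v \<bullet> z - f z \<le> M"
    by blast
qed

lemma f_ge: "P \<bullet> z - M \<le> f z"
  using conj_le[of P z] min_norm_point_in_closure[OF conj_dom_nonempty] by (simp add: P_def)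

lemma M_f_nonneg: "0 \<le> M + f 0"
  using f_ge[of 0] by simp

lemma grad_inner_ge: "(norm P)\<^sup>2 \<le> grad f z \<bullet> P"
  unfolding P_def using min_norm_point_inner[OF convex_conj_dom grad_in_conj_dom[OF f]] .

lemma G_inner_ge: "A k * (norm P)\<^sup>2 \<le> G k \<bullet> P"
proof (induction k)
  case (Suc k)
  have "\<delta> A k * (norm P)\<^sup>2 \<le> \<delta> A k * (g k \<bullet> P)"
    using delta_pos[of k] by (intro mult_left_mono grad_inner_ge) auto
  with Suc show ?case
    by (simp add: G_Suc A_Suc inner_add_left distrib_right)
qed (simp add: A_0 G_def)

section \<open>Energy estimate and the resulting bound on \<open>G\<close>\<close>

lemma estimate:
  "A k * f (x k) + (norm (G k))\<^sup>2 / 8 + (norm P)\<^sup>2 / 8 * (\<Sum>j<k. (\<delta> A j)\<^sup>2) \<le> A k * f 0"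
proof (induction k)
  case 0
  then show ?case by (simp add: A_0 G_def)
next
  case (Suc k)
  define s where "s = (\<delta> A k)\<^sup>2 / (4 * A (Suc k))"
  have s: "0 \<le> s" "s \<le> 1 / L"
    using A_nonneg[of "Suc k"] step_le[of k] by (auto simp: s_def)
  have As: "A (Suc k) * (s / 2 * u) = (\<delta> A k)\<^sup>2 / 8 * u" for u
    using A_pos[of "Suc k"] by (simp add: s_def field_simps)
  have xs: "x (Suc k) = y k - s *\<^sub>R g k"
    by (simp add: s_def)
  have "f (x (Suc k)) \<le> f (y k) - s / 2 * (norm (g k))\<^sup>2 - s / 2 * (norm (grad f (x (Suc k))))\<^sup>2"
    unfolding xs by (rule gradient_step_descent[OF f L s])
  \<comment> \<open>The gradient at the new point is kept as \<open>norm P\<close>;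
    \<open>G_bound_sq\<close> spends this slack.\<close>
  also have "\<dots> \<le> f (y k) - s / 2 * (norm (g k))\<^sup>2 - s / 2 * (norm P)\<^sup>2"
    using norm_le_if_power2_norm_le_inner[OF grad_inner_ge] s
    by (intro diff_left_mono mult_left_mono power_mono) auto
  finally have "A (Suc k) * f (x (Suc k)) \<le> A (Suc k) * (f (y k) - s / 2 * (norm (g k))\<^sup>2 - s / 2 * (norm P)\<^sup>2)"
    using A_nonneg[of "Suc k"] by (rule mult_left_mono)
  then have 1: "A (Suc k) * f (x (Suc k))
      \<le> A (Suc k) * f (y k) - (\<delta> A k)\<^sup>2 / 8 * (norm (g k))\<^sup>2 - (\<delta> A k)\<^sup>2 / 8 * (norm P)\<^sup>2"
    by (simp only: right_diff_distrib As)
  \<comment> \<open>The tangent at \<open>y k\<close> is tested at \<open>x k\<close> and at the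
    starting point 0, with weights \<open>A k\<close> and \<open>\<delta> A k\<close> of sum
    \<open>A (Suc k)\<close>.\<close>
  have 2: "A k * (f (y k) + g k \<bullet> (x k - y k)) \<le> A k * f (x k)"
    using A_nonneg[of k] by (intro mult_left_mono smooth_convex_above_tangent[OF f])
  have 3: "\<delta> A k * (f (y k) - g k \<bullet> y k) \<le> \<delta> A k * f 0"
    using delta_pos[of k] smooth_convex_above_tangent[OF f, of "y k" 0]
    by (intro mult_left_mono) auto
  have "A k *\<^sub>R (x k - y k) = \<delta> A k *\<^sub>R y k + (\<delta> A k / 4) *\<^sub>R G k"
    using y_x_eq[of k] by (simp add: A_Suc algebra_simps)
  from arg_cong[OF this, of "\<lambda>v. g k \<bullet> v"]
  have 4: "A k * (g k \<bullet> (x k - y k)) = \<delta> A k * (g k \<bullet> y k) + \<delta> A k / 4 * (g k \<bullet> G k)"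
    by (simp only: inner_add_right inner_scaleR_right)
  have 5: "(norm (G (Suc k)))\<^sup>2 = (norm (G k))\<^sup>2 + 2 * \<delta> A k * (g k \<bullet> G k) + (\<delta> A k)\<^sup>2 * (norm (g k))\<^sup>2"
    unfolding G_Suc power2_norm_eq_inner
    by (simp add: inner_add_left inner_add_right inner_commute power2_eq_square algebra_simps)
  show ?case
    using 1 2 3 Suc unfolding 5 distrib_left 4 sum.lessThan_Suc A_Suc
    by (simp add: inner_commute algebra_simps add_divide_distrib del: agm_x.simps agm_y.simps)
qed

lemma G_bound_sq: "(norm (G k - A k *\<^sub>R P))\<^sup>2 \<le> 8 * A k * (M + f 0)"
proof -
  \<comment> \<open>This is what remains of \<open>(norm (G k - A k *\<^sub>R P))\<^sup>2\<close>
    after \<open>estimate\<close> and \<open>f_ge\<close> have produced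
    \<open>8 * A k * (M + f 0)\<close>. Each step adds \<open>2 * A k * \<delta> A k * ((norm
    P)\<^sup>2 - g k \<bullet> P)\<close>: the sum of squares from \<open>estimate\<close> absorbs
    the square of \<open>\<delta> A k\<close> in the growth of \<open>(A k)\<^sup>2\<close>.\<close>
  have tele: "- 8 * (P \<bullet> (A k *\<^sub>R x k)) - (norm P)\<^sup>2 * (\<Sum>j<k. (\<delta> A j)\<^sup>2) - 2 * A k * (G k \<bullet> P)
      + (A k)\<^sup>2 * (norm P)\<^sup>2 \<le> 0"
  proof (induction k)
    case 0
    then show ?case by (simp add: A_0)
  next
    case (Suc k)
    have "A k * \<delta> A k * (norm P)\<^sup>2 \<le> A k * \<delta> A k * (g k \<bullet> P)"
      using delta_pos[of k] A_nonneg[of k] by (intro mult_left_mono grad_inner_ge) auto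
    with Suc show ?case
      unfolding x_Suc_eq
      by (simp add: A_Suc G_Suc inner_diff_right inner_add_right inner_add_left inner_commute
          power2_eq_square algebra_simps del: agm_x.simps agm_y.simps)
  qed
  have "A k * (P \<bullet> x k - M) \<le> A k * f (x k)"
    using A_nonneg[of k] f_ge by (intro mult_left_mono)
  moreover have "(norm (G k - A k *\<^sub>R P))\<^sup>2 = (norm (G k))\<^sup>2 - 2 * A k * (G k \<bullet> P) + (A k)\<^sup>2 * (norm P)\<^sup>2"
    unfolding power2_norm_eq_inner
    by (simp add: inner_diff_left inner_diff_right inner_commute power2_eq_square algebra_simps)
  ultimately show ?thesis
    using tele estimate[of k] by (simp add: algebra_simps)
qed

lemma G_bound: "norm (G k - A k *\<^sub>R P) \<le> sqrt (8 * (M + f 0)) * sqrt (A k)"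
proof -
  have "norm (G k - A k *\<^sub>R P) \<le> sqrt (8 * A k * (M + f 0))"
    using G_bound_sq by (rule real_le_rsqrt)
  then show ?thesis
    by (simp add: real_sqrt_mult mult_ac)
qed

lemma weighted_sum_bound:
  "norm (\<Sum>i=1..k. \<delta> A (i - 1) *\<^sub>R (G i - A i *\<^sub>R P))
    \<le> sqrt (8 * (M + f 0)) * (\<Sum>i=1..k. sqrt (A i) * \<delta> A (i - 1))"
  unfolding sum_distrib_left
proof (rule sum_norm_le)
  show "norm (\<delta> A (i - 1) *\<^sub>R (G i - A i *\<^sub>R P)) \<le> sqrt (8 * (M + f 0)) * (sqrt (A i) * \<delta> A (i - 1))" for i
    using mult_left_mono[OF G_bound[of i] less_imp_le[OF delta_pos[of "i - 1"]]] delta_pos[of "i - 1"]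
    by (simp add: mult_ac)
qed

text \<open>Shared last step for both certificates: \<open>S\<close> is the normalising denominator
  and \<open>c / S\<close> the quotient squared in \<open>bound_q\<close> and
  \<open>bound_p\<close>.\<close>

lemma power2_norm_bound:
  assumes "S > 0" and "norm (S *\<^sub>R v) \<le> sqrt (8 * (M + f 0)) * c"
  shows "(norm v)\<^sup>2 \<le> 8 * (c / S)\<^sup>2 * (M + f 0)"
proof -
  have "norm v \<le> sqrt (8 * (M + f 0)) * (c / S)"
    using assms by (simp add: field_simps)
  then have "(norm v)\<^sup>2 \<le> (sqrt (8 * (M + f 0)) * (c / S))\<^sup>2"
    by (intro power_mono) auto
  also have "\<dots> = 8 * (c / S)\<^sup>2 * (M + f 0)"
    using M_f_nonneg by (simp only: power_mult_distrib real_sqrt_pow2 mult_nonneg_nonneg) simp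
  finally show ?thesis .
qed

section \<open>Certificates as weighted averages\<close>

lemma sum_q_pos: "k \<ge> 1 \<Longrightarrow> 0 < (\<Sum>i=1..k. A i * \<delta> A (i - 1))"
  by (intro sum_pos) (auto intro!: mult_pos_pos A_pos delta_pos)

lemma sum_p_pos: "k \<ge> 1 \<Longrightarrow> 0 < (\<Sum>i=1..k. A i * \<delta> A i)"
  by (intro sum_pos) (auto intro!: mult_pos_pos A_pos delta_pos)

lemma agm_q_eq:
  assumes "k \<ge> 1"
  shows "(\<Sum>i=1..k. A i * \<delta> A (i - 1)) *\<^sub>R agm_q f A 0 k = (\<Sum>i=1..k. \<delta> A (i - 1) *\<^sub>R G i)"
proof -
  have "(\<Sum>i=1..k. A i * \<delta> A (i - 1)) *\<^sub>R agm_q f A 0 k = (- 4) *\<^sub>R (A k *\<^sub>R x k)"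
    using sum_q_pos[OF assms] by (simp add: agm_q_def)
  then show ?thesis
    by (simp add: x_eq)
qed

text \<open>In this form \<open>G_bound\<close> applies to each term; \<open>abel_sum\<close>
  rewrites it for the lower bound on the norm.\<close>

lemma agm_p_eq_diff:
  assumes "k \<ge> 1"
  shows "(\<Sum>i=1..k. A i * \<delta> A i) *\<^sub>R agm_p f A 0 k
    = A k *\<^sub>R G (Suc k) - (\<Sum>i=1..k. \<delta> A (i - 1) *\<^sub>R G i)"
proof -
  have "A (Suc k) *\<^sub>R (x (Suc k) - x k) = - (\<delta> A k) *\<^sub>R ((1 / 4) *\<^sub>R G (Suc k) + x k)"
    unfolding scaleR_diff_right x_Suc_eq by (simp add: A_Suc algebra_simps)
  from arg_cong[OF this, of "scaleR (1 / A (Suc k))"]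
  have "x (Suc k) - x k = (1 / A (Suc k)) *\<^sub>R (- (\<delta> A k) *\<^sub>R ((1 / 4) *\<^sub>R G (Suc k) + x k))"
    using A_pos[of "Suc k"] by (simp del: agm_x.simps(2))
  then have "(\<Sum>i=1..k. A i * \<delta> A i) *\<^sub>R agm_p f A 0 k = A k *\<^sub>R G (Suc k) + 4 *\<^sub>R (A k *\<^sub>R x k)"
    using sum_p_pos[OF assms] A_pos[of "Suc k"] delta_pos[of k]
    by (simp add: agm_p_def scaleR_add_right scaleR_diff_right del: agm_x.simps(2))
  then show ?thesis
    by (simp add: x_eq)
qed

text \<open>Summation by parts; since \<open>A 0 = 0\<close>, the gradient \<open>g 0\<close> drops
  out.\<close>

lemma abel_sum:
  "A k *\<^sub>R G (Suc k) - (\<Sum>i=1..k. \<delta> A (i - 1) *\<^sub>R G i) = (\<Sum>i=1..k. (A i * \<delta> A i) *\<^sub>R g i)"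
  by (induction k) (simp_all add: A_0 A_Suc G_Suc algebra_simps)

text \<open>The case of \<open>abel_sum\<close> with every gradient replaced by 1, so that
  \<open>G k\<close> becomes \<open>A k\<close>; it lets \<open>P\<close> be subtracted term by
  term.\<close>

lemma abel_sum_A:
  "A k * A (Suc k) - (\<Sum>i=1..k. A i * \<delta> A (i - 1)) = (\<Sum>i=1..k. A i * \<delta> A i)"
  by (induction k) (simp_all add: A_0 A_Suc algebra_simps)

lemma agm_q_bound:
  assumes "k \<ge> 1"
  shows "(norm (agm_q f A 0 k - P))\<^sup>2 \<le> bound_q A k * (M + f 0)"
proof -
  define S where "S = (\<Sum>i=1..k. A i * \<delta> A (i - 1))"
  have "S *\<^sub>R (agm_q f A 0 k - P) = (\<Sum>i=1..k. \<delta> A (i - 1) *\<^sub>R (G i - A i *\<^sub>R P))"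
    unfolding scaleR_diff_right S_def agm_q_eq[OF assms]
    by (simp add: sum_subtractf scaleR_sum_left mult.commute)
  then have "norm (S *\<^sub>R (agm_q f A 0 k - P)) \<le> sqrt (8 * (M + f 0)) * (\<Sum>i=1..k. sqrt (A i) * \<delta> A (i - 1))"
    using weighted_sum_bound by simp
  from power2_norm_bound[OF _ this] show ?thesis
    using sum_q_pos[OF assms] unfolding S_def bound_q_def by simp
qed

lemma agm_p_bound:
  assumes "k \<ge> 1"
  shows "(norm (agm_p f A 0 k - P))\<^sup>2 \<le> bound_p A k * (M + f 0)"
proof -
  define S where "S = (\<Sum>i=1..k. A i * \<delta> A i)"
  define W where "W = (\<Sum>i=1..k. \<delta> A (i - 1) *\<^sub>R (G i - A i *\<^sub>R P))"
  have "S *\<^sub>R P = (A k * A (Suc k)) *\<^sub>R P - (\<Sum>i=1..k. A i * \<delta> A (i - 1)) *\<^sub>R P"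
    unfolding S_def abel_sum_A[symmetric] by (simp only: scaleR_diff_left)
  then have "S *\<^sub>R (agm_p f A 0 k - P) = A k *\<^sub>R (G (Suc k) - A (Suc k) *\<^sub>R P) - W"
    using agm_p_eq_diff[OF assms] unfolding W_def S_def[symmetric]
    by (simp add: sum_subtractf scaleR_sum_left mult.commute scaleR_diff_right)
  then have "norm (S *\<^sub>R (agm_p f A 0 k - P)) \<le> A k * norm (G (Suc k) - A (Suc k) *\<^sub>R P) + norm W"
    using norm_triangle_ineq4[of "A k *\<^sub>R (G (Suc k) - A (Suc k) *\<^sub>R P)" W] A_nonneg[of k] by simp
  also have "\<dots> \<le> A k * (sqrt (8 * (M + f 0)) * sqrt (A (Suc k)))
      + sqrt (8 * (M + f 0)) * (\<Sum>i=1..k. sqrt (A i) * \<delta> A (i - 1))"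
    unfolding W_def using A_nonneg[of k] by (intro add_mono mult_left_mono G_bound weighted_sum_bound)
  finally have "norm (S *\<^sub>R (agm_p f A 0 k - P))
      \<le> sqrt (8 * (M + f 0)) * (A k * sqrt (A (k + 1)) + (\<Sum>i=1..k. sqrt (A i) * \<delta> A (i - 1)))"
    by (simp add: algebra_simps)
  from power2_norm_bound[OF _ this] show ?thesis
    using sum_p_pos[OF assms] unfolding S_def bound_p_def by simp
qed

lemma norm_agm_q_ge:
  assumes "k \<ge> 1"
  shows "norm P \<le> norm (agm_q f A 0 k)"
proof (rule norm_le_if_power2_norm_le_inner)
  define S where "S = (\<Sum>i=1..k. A i * \<delta> A (i - 1))"
  have "S * (norm P)\<^sup>2 \<le> (\<Sum>i=1..k. \<delta> A (i - 1) * (G i \<bullet> P))"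
    unfolding S_def sum_distrib_right
  proof (rule sum_mono)
    show "A i * \<delta> A (i - 1) * (norm P)\<^sup>2 \<le> \<delta> A (i - 1) * (G i \<bullet> P)" for i
      using mult_left_mono[OF G_inner_ge[of i] less_imp_le[OF delta_pos[of "i - 1"]]] by (simp add: mult_ac)
  qed
  also have "\<dots> = S * (agm_q f A 0 k \<bullet> P)"
    using agm_q_eq[OF assms] unfolding S_def[symmetric]
    by (metis (no_types, lifting) inner_scaleR_left inner_sum_left sum.cong)
  finally show "(norm P)\<^sup>2 \<le> agm_q f A 0 k \<bullet> P"
    using sum_q_pos[OF assms] unfolding S_def by simp
qed

text \<open>The difference form has negative weights on the \<open>G i\<close>, so
  \<open>G_inner_ge\<close> cannot be summed; \<open>abel_sum\<close> gives positive weights on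
  single gradients.\<close>

lemma norm_agm_p_ge:
  assumes "k \<ge> 1"
  shows "norm P \<le> norm (agm_p f A 0 k)"
proof (rule norm_le_if_power2_norm_le_inner)
  define S where "S = (\<Sum>i=1..k. A i * \<delta> A i)"
  have "S * (norm P)\<^sup>2 \<le> (\<Sum>i=1..k. A i * \<delta> A i * (g i \<bullet> P))"
    unfolding S_def sum_distrib_right
    by (intro sum_mono mult_left_mono grad_inner_ge mult_nonneg_nonneg A_nonneg less_imp_le[OF delta_pos])
  also have "\<dots> = S * (agm_p f A 0 k \<bullet> P)"
    using agm_p_eq_diff[OF assms] unfolding abel_sum S_def[symmetric]
    by (metis (no_types, lifting) inner_scaleR_left inner_sum_left sum.cong)
  finally show "(norm P)\<^sup>2 \<le> agm_p f A 0 k \<bullet> P"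
    using sum_p_pos[OF assms] unfolding S_def by simp
qed

section \<open>Detection of unboundedness\<close>

text \<open>A lower bound \<open>c\<close> of \<open>f\<close> bounds the conjugate at 0 by
  \<open>- c\<close>, so 0 itself is in the domain.\<close>

lemma P_eq_0_if_bounded_below:
  assumes "(INF z. ereal (f z)) \<noteq> - \<infinity>"
  shows "P = 0"
proof -
  have "\<exists>c. \<forall>z. c \<le> f z"
  proof (cases "INF z. ereal (f z)")
    case (real r)
    then show ?thesis
      by (metis INF_lower UNIV_I ereal_less_eq(3))
  next
    case PInf
    have "(INF z. ereal (f z)) \<le> ereal (f 0)"
      by (rule INF_lower) simp
    then show ?thesis
      unfolding PInf by simp
  qed (use assms in simp)
  then obtain c where "\<And>z. c \<le> f z"
    by blast
  then have "0 \<in> conj_dom f"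
    by (intro conj_domI[of _ _ "- c"]) simp
  from min_norm_point_inner[OF convex_conj_dom this] show ?thesis
    by (simp add: P_def)
qed

text \<open>Were \<open>f\<close> bounded below, \<open>P = 0\<close> would make the two hypotheses
  contradict each other.\<close>

lemma unbounded_certificate:
  assumes "(norm (v - P))\<^sup>2 \<le> b * (M + f 0)" and "(norm v)\<^sup>2 > b * (M + f 0)"
  shows "(INF z. ereal (f z)) = - \<infinity>"
  using assms P_eq_0_if_bounded_below by fastforce

lemma certificate_holds:
  assumes "norm P \<le> norm v" and "P \<noteq> 0"
    and "ereal b < (if M + f 0 = 0 then \<infinity> else ereal ((norm P)\<^sup>2 / (M + f 0)))"
  shows "(norm v)\<^sup>2 > b * (M + f 0)"
proof -
  have "b * (M + f 0) < (norm P)\<^sup>2"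
  \<comment> \<open>If \<open>M + f 0 = 0\<close>, the threshold is infinite and the left-hand side
    is 0, so \<open>P \<noteq> 0\<close> suffices.\<close>
  proof (cases "M + f 0 = 0")
    case False
    then show ?thesis
      using assms(3) M_f_nonneg by (simp add: pos_less_divide_eq)
  qed (use assms(2) in simp)
  also have "\<dots> \<le> (norm v)\<^sup>2"
    using assms(1) by (intro power_mono) auto
  finally show ?thesis .
qed

end

theorem corollary5p6:
  fixes f :: "real ^ 'n \<Rightarrow> real" and L M :: real and A :: "nat \<Rightarrow> real"
    and pstar :: "real ^ 'n" and p q :: "nat \<Rightarrow> real ^ 'n" and B B' :: "nat \<Rightarrow> real"
  assumes "L > 0"
    and "f \<in> smooth_convex L"
    and "\<forall>v\<in>conj_dom f. conjugate f v \<le> ereal M"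
    and "step_size_condition L A"
  defines "pstar \<equiv> min_norm_point (closure (conj_dom f))"
    and "q \<equiv> agm_q f A 0" and "B' \<equiv> bound_q A"
    and "p \<equiv> agm_p f A 0" and "B \<equiv> bound_p A"
  shows
    "(\<forall>k\<ge>1. (norm (q k - pstar))\<^sup>2 \<le> B' k * (M + f 0)) \<and>
     ((\<exists>k\<ge>1. (norm (q k))\<^sup>2 > B' k * (M + f 0)) \<longrightarrow> (INF x. ereal (f x)) = -\<infinity>) \<and>
     (pstar \<noteq> 0 \<longrightarrow>
        (\<forall>k\<ge>1. ereal (B' k) < (if M + f 0 = 0 then \<infinity> else ereal ((norm pstar)\<^sup>2 / (M + f 0)))
            \<longrightarrow> (norm (q k))\<^sup>2 > B' k * (M + f 0))) \<and>
     (\<forall>k\<ge>1. (norm (p k - pstar))\<^sup>2 \<le> B k * (M + f 0)) \<and>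
     ((\<exists>k\<ge>1. (norm (p k))\<^sup>2 > B k * (M + f 0)) \<longrightarrow> (INF x. ereal (f x)) = -\<infinity>) \<and>
     (pstar \<noteq> 0 \<longrightarrow>
        (\<forall>k\<ge>1. ereal (B k) < (if M + f 0 = 0 then \<infinity> else ereal ((norm pstar)\<^sup>2 / (M + f 0)))
            \<longrightarrow> (norm (p k))\<^sup>2 > B k * (M + f 0)))"
proof -
  interpret agm f L M A
    using assms(1-4) by unfold_locales
  have pstar: "pstar = P"
    by (simp add: pstar_def P_def)
  show ?thesis
    unfolding pstar p_def q_def B_def B'_def
    using agm_q_bound agm_p_bound norm_agm_q_ge norm_agm_p_ge
      unbounded_certificate certificate_holds
    by blast
qed

end
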